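(* Let $Z_1,Z_2$ be i.i.d. random vectors from a distribution $P_Z$ on $\mathbb{R}^d$ such that $\beta^\top Z_1$ has a continuous distribution function for $\lambda$-almost all $\beta\in\mathbb{S}^{d-1}$. Then $$\int_{\mathbb{S}^{d-1}}\Big(\mathbb{P}(\beta^\top Z_1>0)-\frac12\Big)^2d\lambda(\beta)=\frac14-\frac1{2\pi}\mathbb{E}\big[\mathsf{Ang}(Z_1,Z_2)\big].$$
   Context: $\lambda$ is the uniform probability measure on the unit sphere $\mathbb{S}^{d-1}\subset\mathbb{R}^d$; for nonzero $U_1,U_2\in\mathbb{R}^d$, $\mathsf{Ang}(U_1,U_2)=\arccos\{U_1^\top U_2/(\|U_1\|\|U_2\|)\}$. The left side is the projection-averaging generalization of the univariate sign quantity $\mathbb{P}(Z>0)-1/2$. *)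

theory Defs
  imports "HOL-Probability.Probability"
begin

(* Radial projection of the uniform distribution on the unit ball (sgn x = x /R norm x).
   The origin, which sgn maps to 0, is a null set, so restricting to the sphere loses no mass. *)
definition sphere_uniform :: "'a::euclidean_space measure" where
  "sphere_uniform =
     restrict_space (distr (uniform_measure lborel (ball 0 1)) borel sgn) (sphere 0 1)"

(* For u = 0 or v = 0, where the angle is not defined, this yields the junk value arccos 0. *)
definition Ang :: "'a::real_inner \<Rightarrow> 'a \<Rightarrow> real" where
  "Ang u v = arccos ((u \<bullet> v) / (norm u * norm v))"

lemma space_sphere_uniform [simp]: "space sphere_uniform = sphere (0::'a::euclidean_space) 1"
  by (simp add: sphere_uniform_def space_restrict_space)

lemma sets_sphere_uniform [simp, measurable_cong]:
  "sets sphere_uniform = sets (restrict_space borel (sphere (0::'a::euclidean_space) 1))"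
  by (simp add: sphere_uniform_def sets_restrict_space)

lemma prob_space_sphere_uniform: "prob_space (sphere_uniform :: 'a::euclidean_space measure)"
proof -
  let ?U = "uniform_measure lborel (ball (0::'a) 1)"
  let ?D = "distr ?U borel sgn"
  have pos: "emeasure lborel (ball (0::'a) 1) \<noteq> 0"
    using content_ball_pos[of 1 "0::'a"] by (auto simp: measure_def)
  have fin: "emeasure lborel (ball (0::'a) 1) \<noteq> \<infinity>"
    using emeasure_lborel_ball_finite[of "0::'a" 1] by auto
  interpret U: prob_space ?U
    by (rule prob_space_uniform_measure[OF pos fin])
  have meas: "(sgn :: 'a \<Rightarrow> 'a) \<in> measurable ?U borel"
    unfolding sgn_div_norm by simp
  interpret D: prob_space ?D
    by (rule U.prob_space_distr[OF meas])
  have sph: "sphere (0::'a) 1 \<in> sets borel"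
    by (simp add: borel_closed)
  have "AE x in lborel. (x::'a) \<noteq> 0"
    by (rule AE_lborel_singleton)
  then have "AE x in ?U. (x::'a) \<noteq> 0"
    by (intro AE_uniform_measureI) auto
  then have "AE x in ?U. sgn (x::'a) \<in> sphere 0 1"
    by eventually_elim (simp add: norm_sgn)
  then have "AE y in ?D. y \<in> sphere 0 1"
    using sph by (subst AE_distr_iff[OF meas]) auto
  then have "emeasure ?D (sphere 0 1) = 1"
    using sph by (intro D.emeasure_eq_1_AE) auto
  then show ?thesis
    using sph by (intro prob_spaceI) (simp add: sphere_uniform_def emeasure_restrict_space space_restrict_space)
qed

end

theory Submission
  imports Defs
begin

text \<open>
  Let \<open>p(\<beta>)\<close> be the probability that \<open>\<beta> \<bullet> Z1 > 0\<close>. Since \<open>Z1\<close> and \<open>Z2\<close> are independent with the same law,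
  \<open>p(\<beta>)\<^sup>2\<close> is the probability that \<open>\<beta> \<bullet> Z1\<close> and \<open>\<beta> \<bullet> Z2\<close> are both positive, so by Fubini the integral of
  \<open>(p - 1/2)\<^sup>2 = p\<^sup>2 - p + 1/4\<close> reduces to the \<open>\<beta>\<close>-measures of half-spaces and of intersections of two
  half-spaces. The continuity hypothesis serves only to exclude an atom of \<open>Z1\<close> at the origin.

  That \<open>\<beta> \<bullet> u > 0\<close> and \<open>\<beta> \<bullet> v > 0\<close> hold jointly with measure \<open>1/2 - Ang u v / (2 \<pi>)\<close> follows from rotation
  invariance without polar coordinates: the measure of the sector \<open>\<beta> \<bullet> e(0) > 0 \<ge> \<beta> \<bullet> e(\<theta>)\<close>, for \<open>e(\<theta>)\<close>
  running through a half circle, is nonnegative and additive in \<open>\<theta>\<close>, hence linear.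
\<close>

section \<open>Invariance of Lebesgue measure under orthogonal maps\<close>

lemma emeasure_unit_ball:
  "emeasure lborel (ball (0::'a::euclidean_space) 1) \<noteq> 0"
  "emeasure lborel (ball (0::'a::euclidean_space) 1) \<noteq> \<infinity>"
  using content_ball_pos[of 1 "0::'a"] emeasure_lborel_ball_finite[of "0::'a" 1]
  by (auto simp: measure_def)

text \<open>
  Uniqueness of Haar measure: for Borel sets \<open>A\<close>, \<open>B\<close>, translation invariance and Fubini give
  \<open>\<nu>(A) \<lambda>(B) = \<nu>(B) \<lambda>(A)\<close> where \<open>\<nu>\<close> is the image of Lebesgue measure \<open>\<lambda>\<close> under \<open>f\<close>; then take for \<open>B\<close>
  the unit ball, which \<open>f\<close> preserves. (The library's \<open>measure_orthogonal_image\<close> needs a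
  well-ordered index type.)
\<close>

lemma lborel_distr_orthogonal:
  fixes f :: "'a::euclidean_space \<Rightarrow> 'a"
  assumes f: "orthogonal_transformation f"
  shows "distr lborel borel f = lborel"
proof -
  define h where "h = inv f"
  have lin: "linear f" using f by (rule orthogonal_transformation_linear)
  have fh: "f (h y) = y" for y
    unfolding h_def using orthogonal_transformation_surj[OF f] by (rule surj_f_inv_f)
  have f_meas [measurable]: "f \<in> borel_measurable borel"
    using linear_continuous_on[OF linear_conv_bounded_linear[THEN iffD1, OF lin]]
    by (rule borel_measurable_continuous_onI)
  have eq: "emeasure lborel (f -` A) * emeasure lborel B = emeasure lborel (f -` B) * emeasure lborel A"
    if [measurable]: "A \<in> sets borel" "B \<in> sets borel" for A B :: "'a set"
  proof -
    have shift: "(\<integral>\<^sup>+x. g (x + c) \<partial>lborel) = (\<integral>\<^sup>+x. g x \<partial>lborel)"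
      if "g \<in> borel_measurable borel" for g :: "'a \<Rightarrow> ennreal" and c
    proof -
      have "(\<integral>\<^sup>+x. g x \<partial>lborel) = (\<integral>\<^sup>+x. g x \<partial>distr lborel borel ((+) c))"
        by (simp add: lborel_distr_plus)
      also have "\<dots> = (\<integral>\<^sup>+x. g (c + x) \<partial>lborel)"
        using that by (subst nn_integral_distr) auto
      finally show ?thesis by (simp add: add.commute)
    qed
    have reflect: "(\<integral>\<^sup>+x. g (c - x) \<partial>lborel) = (\<integral>\<^sup>+x. g x \<partial>lborel)"
      if [measurable]: "g \<in> borel_measurable borel" for g :: "'a \<Rightarrow> ennreal" and c
    proof -
      have "(\<integral>\<^sup>+x. g x \<partial>lborel)
          = (\<integral>\<^sup>+x. g x \<partial>density (distr lborel borel (\<lambda>x. c + (-1) *\<^sub>R x)) (\<lambda>_. ennreal (\<bar>-1\<bar> ^ DIM('a))))"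
        by (rule arg_cong[where f="\<lambda>M. nn_integral M g"], rule lborel_affine) simp
      also have "\<dots> = (\<integral>\<^sup>+x. g (c - x) \<partial>lborel)"
        by (simp add: nn_integral_density nn_integral_distr)
      finally show ?thesis by simp
    qed
    have em: "emeasure lborel (f -` C) = (\<integral>\<^sup>+x. indicator C (f x) \<partial>lborel)"
      if "C \<in> sets borel" for C :: "'a set"
    proof -
      have "f -` C \<in> sets borel"
        using measurable_sets[OF f_meas that] by simp
      then have "emeasure lborel (f -` C) = (\<integral>\<^sup>+x. indicator (f -` C) x \<partial>lborel)" by simp
      then show ?thesis by (simp add: indicator_def)
    qed
    \<comment> \<open>Three substitutions trade \<open>A\<close> and \<open>B\<close>:
      \<open>y\<close> becomes \<open>y + f x\<close>; after Fubini, \<open>x\<close> becomes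
      \<open>x + h (- y)\<close>, which turns \<open>f x\<close> into \<open>f x - y\<close>; after
      Fubini again, \<open>y\<close> becomes \<open>f x - y\<close>, so that the integrand is a
      product in which \<open>y\<close> enters only through \<open>A\<close>.\<close>
    have "emeasure lborel (f -` A) * emeasure lborel B
      = (\<integral>\<^sup>+x. (\<integral>\<^sup>+y. indicator A (f x) * indicator B y \<partial>lborel) \<partial>lborel)"
      by (simp add: em nn_integral_cmult nn_integral_multc)
    also have "\<dots> = (\<integral>\<^sup>+x. (\<integral>\<^sup>+y. indicator A (f x) * indicator B (y + f x) \<partial>lborel) \<partial>lborel)"
    proof (rule nn_integral_cong)
      fix x
      show "(\<integral>\<^sup>+y. indicator A (f x) * indicator B y \<partial>lborel)
          = (\<integral>\<^sup>+y. indicator A (f x) * indicator B (y + f x) \<partial>lborel)"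
        by (rule shift[symmetric, of "\<lambda>y. indicator A (f x) * indicator B y"]) measurable
    qed
    also have "\<dots> = (\<integral>\<^sup>+y. (\<integral>\<^sup>+x. indicator A (f x) * indicator B (y + f x) \<partial>lborel) \<partial>lborel)"
      by (rule lborel_pair.Fubini') measurable
    also have "\<dots> = (\<integral>\<^sup>+y. (\<integral>\<^sup>+x. indicator A (f x - y) * indicator B (f x) \<partial>lborel) \<partial>lborel)"
    proof (rule nn_integral_cong)
      fix y
      have "(\<integral>\<^sup>+x. indicator A (f x) * indicator B (y + f x) \<partial>lborel)
          = (\<integral>\<^sup>+x. indicator A (f (x + h (- y))) * indicator B (y + f (x + h (- y))) \<partial>lborel)"
        by (rule shift[symmetric, of "\<lambda>x. indicator A (f x) * indicator B (y + f x)"]) measurable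
      then show "(\<integral>\<^sup>+x. indicator A (f x) * indicator B (y + f x) \<partial>lborel)
          = (\<integral>\<^sup>+x. indicator A (f x - y) * indicator B (f x) \<partial>lborel)"
        by (simp add: linear_add[OF lin] fh)
    qed
    also have "\<dots> = (\<integral>\<^sup>+x. (\<integral>\<^sup>+y. indicator A (f x - y) * indicator B (f x) \<partial>lborel) \<partial>lborel)"
      by (rule lborel_pair.Fubini') measurable
    also have "\<dots> = (\<integral>\<^sup>+x. (\<integral>\<^sup>+y. indicator A y * indicator B (f x) \<partial>lborel) \<partial>lborel)"
    proof (rule nn_integral_cong)
      fix x
      show "(\<integral>\<^sup>+y. indicator A (f x - y) * indicator B (f x) \<partial>lborel)
          = (\<integral>\<^sup>+y. indicator A y * indicator B (f x) \<partial>lborel)"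
        by (rule reflect[of "\<lambda>y. indicator A y * indicator B (f x)"]) measurable
    qed
    also have "\<dots> = emeasure lborel (f -` B) * emeasure lborel A"
      by (simp add: em nn_integral_cmult nn_integral_multc mult.commute)
    finally show ?thesis .
  qed
  let ?B = "ball 0 1 :: 'a set"
  have B: "f -` ?B = ?B"
    using orthogonal_transformation_norm[OF f] by auto
  show ?thesis
  proof (rule measure_eqI)
    fix A assume "A \<in> sets (distr lborel borel f)"
    then have A: "A \<in> sets borel" by simp
    have "emeasure lborel ?B * emeasure lborel (f -` A) = emeasure lborel ?B * emeasure lborel A"
      using eq[OF A, of ?B] B by (simp add: mult.commute)
    then have "emeasure lborel (f -` A) = emeasure lborel A"
      using emeasure_unit_ball[where 'a='a] by (simp add: ennreal_mult_cancel_left)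
    then show "emeasure (distr lborel borel f) A = emeasure lborel A"
      using A by (simp add: emeasure_distr)
  qed simp
qed

section \<open>The uniform measure on the sphere: invariance, hyperplanes, half-spaces\<close>

lemma measurable_vector_sgn [measurable]:
  "(sgn :: 'a::euclidean_space \<Rightarrow> 'a) \<in> borel_measurable borel"
  unfolding sgn_div_norm by measurable

text \<open>Unfolding the radial projection turns an event on the sphere into a cone cut by the unit
  ball, so that facts about Lebesgue measure apply.\<close>

lemma prob_sphere_uniform:
  fixes P :: "'a::euclidean_space \<Rightarrow> bool"
  assumes P: "{x. P x} \<in> sets borel"
  shows "\<P>(\<beta> in sphere_uniform. P \<beta>)
    = measure lborel (ball 0 1 \<inter> {x. P (sgn x)}) / measure lborel (ball (0::'a) 1)"
proof -
  have S: "sphere 0 1 \<in> sets (borel :: 'a measure)"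
    by (simp add: borel_closed)
  have meas: "{x \<in> sphere 0 1. P x} \<in> sets borel"
    using sets.Int[OF P S] by (simp add: Int_def conj_commute)
  have sg: "sgn -` {x \<in> sphere 0 1. P x} \<in> sets (borel :: 'a measure)"
    using measurable_sets[OF measurable_vector_sgn meas] by simp
  have ss: "sgn -` {x. P x} \<in> sets (borel :: 'a measure)"
    using measurable_sets[OF measurable_vector_sgn P] by simp
  have "\<P>(\<beta> in sphere_uniform. P \<beta>)
    = measure (distr (uniform_measure lborel (ball (0::'a) 1)) borel sgn) {x \<in> sphere 0 1. P x}"
    unfolding space_sphere_uniform unfolding sphere_uniform_def
    using S by (subst measure_restrict_space) auto
  also have "\<dots> = measure (uniform_measure lborel (ball (0::'a) 1)) (sgn -` {x \<in> sphere 0 1. P x})"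
    using meas by (subst measure_distr) auto
  also have "\<dots> = measure lborel (ball 0 1 \<inter> sgn -` {x \<in> sphere 0 1. P x}) / measure lborel (ball (0::'a) 1)"
    using emeasure_unit_ball[where 'a='a] sg by simp
  also have "measure lborel (ball 0 1 \<inter> sgn -` {x \<in> sphere 0 1. P x})
      = measure lborel (ball 0 1 \<inter> {x. P (sgn x)})"
  proof (rule measure_eq_AE)
    \<comment> \<open>The two sets can differ only at the origin, which \<open>sgn\<close> maps off
      the sphere to 0.\<close>
    show "AE x in lborel. (x \<in> ball 0 1 \<inter> sgn -` {x \<in> sphere 0 1. P x}) = (x \<in> ball 0 1 \<inter> {x. P (sgn x)})"
      using AE_lborel_singleton[of "0::'a"] by eventually_elim (auto simp: norm_sgn)
  qed (use sg ss in \<open>auto simp: vimage_def\<close>)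
  finally show ?thesis .
qed

text \<open>A linear isometry commutes with \<open>sgn\<close> and preserves the unit ball, so the
  invariance of Lebesgue measure carries over to the sphere.\<close>

lemma prob_sphere_uniform_orthogonal:
  fixes f :: "'a::euclidean_space \<Rightarrow> 'a"
  assumes f: "orthogonal_transformation f" and P: "{x. P x} \<in> sets borel"
  shows "\<P>(\<beta> in sphere_uniform. P (f \<beta>)) = \<P>(\<beta> in sphere_uniform. P \<beta>)"
proof -
  have lin: "linear f" using f by (rule orthogonal_transformation_linear)
  have f_meas: "f \<in> borel_measurable borel"
    using linear_continuous_on[OF linear_conv_bounded_linear[THEN iffD1, OF lin]]
    by (rule borel_measurable_continuous_onI)
  have Pf: "{x. P (f x)} \<in> sets borel"
    using measurable_sets[OF f_meas P] by (simp add: vimage_def)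
  have sg: "f (sgn x) = sgn (f x)" for x
    by (simp add: sgn_div_norm orthogonal_transformation_norm[OF f] linear_scale[OF lin])
  have ss: "{x. P (sgn x)} \<in> sets borel"
    using measurable_sets[OF measurable_vector_sgn P] by (simp add: vimage_def)
  have "ball 0 1 \<inter> {x. P (f (sgn x))} = f -` (ball 0 1 \<inter> {x. P (sgn x)})"
    by (auto simp: sg orthogonal_transformation_norm[OF f])
  then have "measure lborel (ball 0 1 \<inter> {x. P (f (sgn x))})
     = measure (distr lborel borel f) (ball 0 1 \<inter> {x. P (sgn x)})"
    using ss f_meas by (subst measure_distr) auto
  then show ?thesis
    unfolding prob_sphere_uniform[OF P] prob_sphere_uniform[OF Pf] lborel_distr_orthogonal[OF f] by simp
qed

text \<open>The cone over a great subsphere is the hyperplane itself, a Lebesgue null set.\<close>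

lemma prob_sphere_uniform_hyperplane:
  fixes u :: "'a::euclidean_space"
  assumes "u \<noteq> 0"
  shows "\<P>(\<beta> in sphere_uniform. \<beta> \<bullet> u = 0) = 0"
proof -
  have H: "{x. u \<bullet> x = 0} \<in> null_sets lborel"
    using negligible_hyperplane[of u 0] assms closed_hyperplane[of u 0]
    by (simp add: negligible_iff_null_sets null_sets_completion_iff borel_closed)
  have "ball 0 1 \<inter> {x. sgn x \<bullet> u = 0} = ball 0 1 \<inter> {x. u \<bullet> x = 0}"
    using assms by (auto simp: sgn_div_norm inner_commute)
  moreover have "measure lborel (ball 0 1 \<inter> {x. u \<bullet> x = 0}) = 0"
    using null_set_Int1[OF H, of "ball 0 1"] by (simp add: measure_eq_0_null_sets Int_commute)
  ultimately show ?thesis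
    by (subst prob_sphere_uniform) auto
qed

lemma (in prob_space) prob_disj_exclusive:
  assumes [measurable]: "Measurable.pred M P" "Measurable.pred M Q"
    and excl: "\<And>x. \<not> (P x \<and> Q x)"
  shows "\<P>(x in M. P x \<or> Q x) = \<P>(x in M. P x) + \<P>(x in M. Q x)"
proof -
  have "{x \<in> space M. P x \<or> Q x} = {x \<in> space M. P x} \<union> {x \<in> space M. Q x}" by auto
  moreover have "{x \<in> space M. P x} \<inter> {x \<in> space M. Q x} = {}" using excl by auto
  ultimately show ?thesis by (simp add: finite_measure_Union)
qed

lemma measurable_sphere_uniform_ident [measurable]:
  "(\<lambda>\<beta>. \<beta>) \<in> measurable (sphere_uniform :: 'a::euclidean_space measure) borel"
  by (subst measurable_cong_sets[OF sets_sphere_uniform refl])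
     (rule measurable_restrict_space1[OF measurable_ident_sets[OF refl]])

lemma AE_sphere_uniform_inner_nonzero:
  fixes u :: "'a::euclidean_space"
  assumes "u \<noteq> 0"
  shows "AE \<beta> in sphere_uniform. \<beta> \<bullet> u \<noteq> 0"
proof -
  interpret S: prob_space "sphere_uniform :: 'a measure" by (rule prob_space_sphere_uniform)
  have m: "{\<beta> \<in> space sphere_uniform. \<beta> \<bullet> u = 0} \<in> sets sphere_uniform" by measurable
  have "AE \<beta> in sphere_uniform. \<beta> \<notin> {\<beta> \<in> space sphere_uniform. \<beta> \<bullet> u = 0}"
    using S.prob_eq_0[OF m] prob_sphere_uniform_hyperplane[OF assms] by blast
  then show ?thesis using AE_space by eventually_elim auto
qed

text \<open>The antipodal map exchanges the two open half-spaces, and the hyperplane between them is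
  null.\<close>

lemma prob_sphere_uniform_halfspace:
  fixes u :: "'a::euclidean_space"
  assumes "u \<noteq> 0"
  shows "\<P>(\<beta> in sphere_uniform. \<beta> \<bullet> u > 0) = 1 / 2"
proof -
  interpret S: prob_space "sphere_uniform :: 'a measure" by (rule prob_space_sphere_uniform)
  have neg: "\<P>(\<beta> in sphere_uniform. (- \<beta>) \<bullet> u > 0) = \<P>(\<beta> in sphere_uniform. \<beta> \<bullet> u > 0)"
    using orthogonal_transformation_neg[of "\<lambda>x::'a. x"]
    by (intro prob_sphere_uniform_orthogonal) auto
  have "\<P>(\<beta> in sphere_uniform. (- \<beta>) \<bullet> u > 0) = \<P>(\<beta> in sphere_uniform. \<not> \<beta> \<bullet> u > 0)"
  proof (rule measure_eq_AE)
    show "AE \<beta> in sphere_uniform. (\<beta> \<in> {\<beta> \<in> space sphere_uniform. (- \<beta>) \<bullet> u > 0})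
        = (\<beta> \<in> {\<beta> \<in> space sphere_uniform. \<not> \<beta> \<bullet> u > 0})"
      using AE_sphere_uniform_inner_nonzero[OF assms] by eventually_elim auto
  qed measurable
  also have "\<dots> = 1 - \<P>(\<beta> in sphere_uniform. \<beta> \<bullet> u > 0)"
    by (rule S.prob_neg) measurable
  finally show ?thesis using neg by linarith
qed

section \<open>Measure of a sector via Cauchy's functional equation\<close>

text \<open>Nonnegative increments make \<open>F\<close> monotone, and additivity fixes its values
  at multiples of \<open>L / (n + 1)\<close>; monotonicity squeezes \<open>F\<close> between these
  grid values as \<open>n\<close> grows.\<close>

lemma additive_nonneg_imp_linear:
  fixes F :: "real \<Rightarrow> real"
  assumes L: "L > 0"
    and add: "\<And>x y. 0 \<le> x \<Longrightarrow> 0 \<le> y \<Longrightarrow> x + y \<le> L \<Longrightarrow> F (x + y) = F x + F y"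
    and nonneg: "\<And>x. 0 \<le> x \<Longrightarrow> x \<le> L \<Longrightarrow> F x \<ge> 0"
    and x: "0 \<le> x" "x \<le> L"
  shows "F x = F L * x / L"
proof -
  have mono: "F s \<le> F t" if "0 \<le> s" "s \<le> t" "t \<le> L" for s t
    using add[of s "t - s"] nonneg[of "t - s"] that by simp
  have mult: "F (real k * s) = real k * F s" if "0 \<le> s" "real k * s \<le> L" for k s
    using that
  proof (induction k)
    case 0
    then show ?case using add[of 0 0] L by simp
  next
    case (Suc k)
    have "F (real k * s + s) = F (real k * s) + F s"
      using Suc.prems by (intro add) (auto simp: algebra_simps)
    then show ?case using Suc by (simp add: algebra_simps)
  qed
  \<comment> \<open>With mesh \<open>d = L / (n + 1)\<close> and \<open>k\<close> the grid index
    just below \<open>x\<close>, both \<open>F x\<close> and the linear value lie between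
    \<open>k * F d\<close> and \<open>(k + 1) * F d\<close>, hence differ by at most
    \<open>F d\<close>.\<close>
  have bound: "\<bar>F x - F L * x / L\<bar> \<le> F L / real (Suc n)" for n
  proof -
    define d where "d = L / real (Suc n)"
    have d: "d > 0" using L by (simp add: d_def)
    have Fd: "F L = real (Suc n) * F d"
      using mult[of d "Suc n"] d by (simp add: d_def)
    define k where "k = nat \<lfloor>x / d\<rfloor>"
    have rk: "real k = of_int \<lfloor>x / d\<rfloor>" using x d by (simp add: k_def)
    have kd: "real k \<le> x / d" "x / d < real k + 1" unfolding rk by linarith+
    then have k: "real k * d \<le> x" "x \<le> (real k + 1) * d"
      using d by (simp_all add: field_simps)
    have dL: "d \<le> L" using L by (simp add: d_def field_simps)
    have Fk: "F (real k * d) = real k * F d" using k x d by (intro mult) auto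
    have lower: "real k * F d \<le> F x"
      using mono[of "real k * d" x] k x d Fk by simp
    \<comment> \<open>The right grid point \<open>(k + 1) * d\<close> may lie beyond
      \<open>L\<close>, where nothing is known about \<open>F\<close>; the upper bound therefore
      compares the remainder \<open>x - k * d\<close> with \<open>d\<close>.\<close>
    have "F x = F (real k * d) + F (x - real k * d)"
      using add[of "real k * d" "x - real k * d"] k x d by simp
    also have "F (x - real k * d) \<le> F d"
      using k dL by (intro mono) (auto simp: algebra_simps)
    finally have upper: "F x \<le> (real k + 1) * F d" using Fk by (simp add: algebra_simps)
    have Fd0: "F d \<ge> 0" using d dL by (intro nonneg) auto
    have eq: "F L * x / L = (x / d) * F d"
      using L by (simp add: Fd d_def field_simps)
    have "real k * F d \<le> (x / d) * F d" "(x / d) * F d \<le> (real k + 1) * F d"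
      using kd Fd0 by (intro mult_right_mono; linarith)+
    moreover have "F L / real (Suc n) = F d" by (simp add: Fd)
    ultimately show ?thesis using lower upper eq by (simp add: algebra_simps abs_le_iff)
  qed
  have "(\<lambda>n. F L / real (Suc n)) \<longlonglongrightarrow> 0"
    by (rule LIMSEQ_Suc[OF lim_const_over_n])
  then have "\<bar>F x - F L * x / L\<bar> \<le> 0"
    by (rule LIMSEQ_le_const) (use bound in auto)
  then show ?thesis by simp
qed

text \<open>Householder reflections; pairs of them will supply the plane rotations.\<close>

lemma orthogonal_transformation_reflection:
  fixes w :: "'a::euclidean_space"
  assumes "norm w = 1"
  shows "orthogonal_transformation (\<lambda>x. x - (2 * (x \<bullet> w)) *\<^sub>R w)"
proof -
  have "w \<bullet> w = 1" using assms by (simp add: dot_square_norm)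
  then show ?thesis
    unfolding orthogonal_transformation_def
    by (auto intro!: linearI simp: inner_simps algebra_simps inner_commute)
qed

text \<open>The sector measure \<open>W s t\<close> depends only on \<open>t - s\<close>, so
  \<open>W 0\<close> is additive on \<open>[0, pi]\<close>; being nonnegative with value 1/2 at
  \<open>pi\<close>, it has slope \<open>1 / (2 * pi)\<close>.\<close>

lemma prob_sphere_uniform_sector:
  fixes a b :: "'a::euclidean_space"
  assumes a: "norm a = 1" and b: "norm b = 1" and ab: "a \<bullet> b = 0"
    and \<theta>: "0 \<le> \<theta>" "\<theta> \<le> pi"
  shows "\<P>(\<beta> in sphere_uniform. \<beta> \<bullet> a > 0 \<and> \<beta> \<bullet> (cos \<theta> *\<^sub>R a + sin \<theta> *\<^sub>R b) \<le> 0) = \<theta> / (2 * pi)"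
proof -
  interpret S: prob_space "sphere_uniform :: 'a measure" by (rule prob_space_sphere_uniform)
  have aa: "a \<bullet> a = 1" and bb: "b \<bullet> b = 1" and ba: "b \<bullet> a = 0"
    using a b ab by (simp_all add: dot_square_norm inner_commute)
  define e where "e t = cos t *\<^sub>R a + sin t *\<^sub>R b" for t
  define W where "W s t = \<P>(\<beta> in sphere_uniform. \<beta> \<bullet> e s > 0 \<and> \<beta> \<bullet> e t \<le> 0)" for s t
  have e_inner: "e s \<bullet> e t = cos (s - t)" for s t
    by (simp add: e_def inner_simps aa bb ab ba cos_diff)
  have norm_e: "norm (e t) = 1" for t
    using e_inner[of t t] by (simp add: norm_eq_1)
  \<comment> \<open>The normal at angle \<open>c / 2 + pi / 2\<close> makes \<open>e (c / 2)\<close>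
    span the mirror line within the plane, so angle \<open>s\<close> goes to
    \<open>c - s\<close>.\<close>
  have e_reflect: "e s - (2 * (e s \<bullet> e (c / 2 + pi / 2))) *\<^sub>R e (c / 2 + pi / 2) = e (c - s)" for s c
  proof -
    have "e s \<bullet> e (c / 2 + pi / 2) = cos ((s - c / 2) - pi / 2)"
      by (simp add: e_inner algebra_simps)
    then have i: "e s \<bullet> e (c / 2 + pi / 2) = sin (s - c / 2)"
      by (simp only: cos_diff) simp
    define p q where "p = s - c / 2" and "q = c / 2"
    have s: "s = p + q" and c: "c - s = q - p" by (simp_all add: p_def q_def)
    have cos_eq: "cos (c - s) = cos s + 2 * sin p * sin q"
      unfolding c unfolding s by (simp add: cos_add cos_diff)
    have sin_eq: "sin (c - s) = sin s - 2 * sin p * cos q"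
      unfolding c unfolding s by (simp add: sin_add sin_diff)
    have w_eq: "e (c / 2 + pi / 2) = - sin q *\<^sub>R a + cos q *\<^sub>R b"
      by (simp add: e_def q_def cos_add sin_add)
    show ?thesis
      unfolding i p_def[symmetric] unfolding w_eq e_def[of s] e_def[of "c - s"] cos_eq sin_eq
      by (simp add: algebra_simps)
  qed
  have W_reflect: "W (c - s) (c - t) = W s t" for s t c
  proof -
    define w where "w = e (c / 2 + pi / 2)"
    have adj: "(\<beta> - (2 * (\<beta> \<bullet> w)) *\<^sub>R w) \<bullet> e s = \<beta> \<bullet> e (c - s)" for \<beta> s
      unfolding e_reflect[of s c, symmetric] w_def by (simp add: inner_simps inner_commute)
    have "orthogonal_transformation (\<lambda>x. x - (2 * (x \<bullet> w)) *\<^sub>R w)"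
      by (rule orthogonal_transformation_reflection) (simp add: w_def norm_e)
    from prob_sphere_uniform_orthogonal[OF this, of "\<lambda>\<beta>. \<beta> \<bullet> e s > 0 \<and> \<beta> \<bullet> e t \<le> 0"]
    show ?thesis unfolding adj W_def by simp
  qed
  \<comment> \<open>a rotation of the plane is a product of two reflections\<close>
  have W_shift: "W (c + s) (c + t) = W s t" for s t c
    using W_reflect[of 0 s t] W_reflect[of c "- s" "- t"] by simp
  \<comment> \<open>Linear dependence of three vectors in the plane: when the sines are nonnegative,
    it places \<open>e x\<close> between \<open>e 0\<close> and \<open>e (x + y)\<close>.\<close>
  have interp: "sin (x + y) * (\<beta> \<bullet> e x) = sin y * (\<beta> \<bullet> e 0) + sin x * (\<beta> \<bullet> e (x + y))" for x y \<beta>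
  proof -
    have "sin y = sin (x + y) * cos x - cos (x + y) * sin x"
      using sin_diff[of "x + y" x] by simp
    then have "sin (x + y) * cos x * (\<beta> \<bullet> a) = (sin y + sin x * cos (x + y)) * (\<beta> \<bullet> a)"
      by (simp add: mult.commute)
    moreover have "\<beta> \<bullet> e t = cos t * (\<beta> \<bullet> a) + sin t * (\<beta> \<bullet> b)" for t
      by (simp add: e_def inner_simps)
    ultimately show ?thesis by (simp add: algebra_simps)
  qed
  have W_add: "W 0 (x + y) = W 0 x + W 0 y" if xy: "0 \<le> x" "0 \<le> y" "x + y \<le> pi" for x y
  proof -
    have pos: "sin z > 0 \<or> z = 0 \<or> z = pi" if "0 \<le> z" "z \<le> pi" for z
      using that sin_gt_zero[of z] by linarith
    \<comment> \<open>The large sector is split by the sign of \<open>\<beta> \<bullet> e x\<close>.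
      By \<open>interp\<close>, each small sector lies in the large one, up to the null set
      \<open>\<beta> \<bullet> e 0 = 0\<close>.\<close>
    have "W 0 (x + y) = \<P>(\<beta> in sphere_uniform. (\<beta> \<bullet> e 0 > 0 \<and> \<beta> \<bullet> e x \<le> 0) \<or> (\<beta> \<bullet> e x > 0 \<and> \<beta> \<bullet> e (x + y) \<le> 0))"
      unfolding W_def
    proof (rule measure_eq_AE)
      have "e 0 \<noteq> 0" using norm_e[of 0] by auto
      from AE_sphere_uniform_inner_nonzero[OF this]
      show "AE \<beta> in sphere_uniform. (\<beta> \<in> {\<beta> \<in> space sphere_uniform. \<beta> \<bullet> e 0 > 0 \<and> \<beta> \<bullet> e (x + y) \<le> 0})
        = (\<beta> \<in> {\<beta> \<in> space sphere_uniform. (\<beta> \<bullet> e 0 > 0 \<and> \<beta> \<bullet> e x \<le> 0) \<or> (\<beta> \<bullet> e x > 0 \<and> \<beta> \<bullet> e (x + y) \<le> 0)})"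
      proof eventually_elim
        case (elim \<beta>)
        note I = interp[of x y \<beta>]
        have sxy: "sin (x + y) \<ge> 0" "sin x \<ge> 0" "sin y \<ge> 0"
          using xy by (auto intro!: sin_ge_zero)
        have 1: "\<beta> \<bullet> e (x + y) \<le> 0" if "\<beta> \<bullet> e 0 > 0" "\<beta> \<bullet> e x \<le> 0"
        proof -
          \<comment> \<open>Dividing by \<open>sin x\<close> fails at the endpoints: for
            \<open>x = 0\<close> the two assumptions contradict each other, and
            \<open>x = pi\<close> forces \<open>y = 0\<close>, so
            \<open>e (x + y) = e x\<close>.\<close>
          consider "sin x > 0" | "x = 0" | "x = pi" "y = 0" using pos[of x] xy by fastforce
          then show ?thesis
          proof cases
            case 1
            have "sin (x + y) * (\<beta> \<bullet> e x) \<le> 0" "sin y * (\<beta> \<bullet> e 0) \<ge> 0"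
              using sxy that by (auto simp: mult_nonneg_nonpos)
            then have "sin x * (\<beta> \<bullet> e (x + y)) \<le> 0" using I by linarith
            then show ?thesis using 1 by (simp add: mult_le_0_iff)
          qed (use that in auto)
        qed
        \<comment> \<open>Here \<open>interp\<close> yields only \<ge>; strictness comes from
          excluding the hyperplane \<open>\<beta> \<bullet> e 0 = 0\<close>.\<close>
        have 2: "\<beta> \<bullet> e 0 > 0" if "\<beta> \<bullet> e x > 0" "\<beta> \<bullet> e (x + y) \<le> 0"
        proof -
          consider "sin y > 0" | "y = 0" | "y = pi" "x = 0" using pos[of y] xy by fastforce
          then show ?thesis
          proof cases
            case 1
            have "sin (x + y) * (\<beta> \<bullet> e x) \<ge> 0" "sin x * (\<beta> \<bullet> e (x + y)) \<le> 0"
              using sxy that by (auto simp: mult_nonneg_nonpos)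
            then have "sin y * (\<beta> \<bullet> e 0) \<ge> 0" using I by linarith
            then show ?thesis using 1 elim by (simp add: zero_le_mult_iff)
          qed (use that in auto)
        qed
        show ?case using 1 2 by fastforce
      qed
    qed measurable
    also have "\<dots> = W 0 x + W x (x + y)"
      unfolding W_def
    proof (rule S.prob_disj_exclusive)
      show "\<not> ((\<beta> \<bullet> e 0 > 0 \<and> \<beta> \<bullet> e x \<le> 0) \<and> (\<beta> \<bullet> e x > 0 \<and> \<beta> \<bullet> e (x + y) \<le> 0))" for \<beta>
        by auto
    qed measurable
    also have "W x (x + y) = W 0 y" using W_shift[of x 0 y] by simp
    finally show ?thesis .
  qed
  have Wpi: "W 0 pi = 1 / 2"
  proof -
    \<comment> \<open>Since \<open>e pi = - a\<close>, the second condition follows from the first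
      and the sector is a half-space.\<close>
    have "W 0 pi = \<P>(\<beta> in sphere_uniform. \<beta> \<bullet> a > 0)"
      unfolding W_def by (rule arg_cong[where f="measure sphere_uniform"]) (auto simp: e_def)
    then show ?thesis using prob_sphere_uniform_halfspace[of a] a by force
  qed
  have "W 0 \<theta> = W 0 pi * \<theta> / pi"
    using W_add \<theta> by (intro additive_nonneg_imp_linear) (auto simp: W_def)
  then show ?thesis by (simp add: Wpi) (simp add: W_def e_def)
qed

section \<open>Angles and intersections of two half-spaces\<close>

lemma abs_cosine_le_1:
  fixes u v :: "'a::real_inner"
  shows "\<bar>(u \<bullet> v) / (norm u * norm v)\<bar> \<le> 1"
  using Cauchy_Schwarz_ineq2[of u v] by (cases "u = 0 \<or> v = 0") (auto simp: abs_mult divide_le_eq_1)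

lemma Ang_nonneg: "0 \<le> Ang u v" and Ang_le_pi: "Ang u v \<le> pi"
  and cos_Ang: "cos (Ang u v) = (u \<bullet> v) / (norm u * norm v)"
  using abs_cosine_le_1[of u v]
  unfolding Ang_def by (auto intro!: arccos_lbound arccos_ubound cos_arccos_abs simp only: abs_le_iff minus_le_iff)

lemma borel_measurable_Ang:
  fixes f g :: "'a \<Rightarrow> 'b::euclidean_space"
  assumes [measurable]: "f \<in> borel_measurable M" "g \<in> borel_measurable M"
  shows "(\<lambda>x. Ang (f x) (g x)) \<in> borel_measurable M"
proof -
  \<comment> \<open>\<open>arccos\<close> is unspecified outside \<open>[-1, 1]\<close>, so its argument is clamped to that interval.\<close>
  have [measurable]: "(\<lambda>t. arccos (max (-1) (min 1 t))) \<in> borel_measurable borel"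
    by (intro borel_measurable_continuous_onI continuous_intros) auto
  have "Ang u v = arccos (max (-1) (min 1 ((u \<bullet> v) / (norm u * norm v))))" for u v :: 'b
    using abs_cosine_le_1[of u v] by (simp add: Ang_def abs_le_iff del: abs_divide)
  then show ?thesis by simp
qed

text \<open>Removing the sector \<open>\<beta> \<bullet> u > 0 \<ge> \<beta> \<bullet> v\<close>, of
  measure \<open>Ang u v / (2 * pi)\<close>, from the half-space
  \<open>\<beta> \<bullet> u > 0\<close> leaves the quadrant.\<close>

lemma prob_sphere_uniform_quadrant:
  fixes u v :: "'a::euclidean_space"
  assumes u: "u \<noteq> 0" and v: "v \<noteq> 0"
  shows "\<P>(\<beta> in sphere_uniform. \<beta> \<bullet> u > 0 \<and> \<beta> \<bullet> v > 0) = 1 / 2 - Ang u v / (2 * pi)"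
proof -
  interpret S: prob_space "sphere_uniform :: 'a measure" by (rule prob_space_sphere_uniform)
  define a c where "a = sgn u" and "c = sgn v"
  have a1: "norm a = 1" and c1: "norm c = 1" using u v by (simp_all add: a_def c_def norm_sgn)
  then have aa: "a \<bullet> a = 1" and cc: "c \<bullet> c = 1" by (simp_all add: dot_square_norm)
  have a0: "a \<noteq> 0" using a1 by auto
  define \<theta> where "\<theta> = Ang u v"
  have \<theta>: "0 \<le> \<theta>" "\<theta> \<le> pi" and cos\<theta>: "cos \<theta> = a \<bullet> c"
    by (simp_all add: \<theta>_def Ang_nonneg Ang_le_pi cos_Ang a_def c_def sgn_div_norm field_simps)
  have pu: "\<beta> \<bullet> u > 0 \<longleftrightarrow> \<beta> \<bullet> a > 0" and pv: "\<beta> \<bullet> v > 0 \<longleftrightarrow> \<beta> \<bullet> c > 0" for \<beta>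
    using u v by (simp_all add: a_def c_def sgn_div_norm zero_less_mult_iff)
  have half: "\<P>(\<beta> in sphere_uniform. \<beta> \<bullet> a > 0) = 1 / 2"
    using a0 by (rule prob_sphere_uniform_halfspace)
  have "\<P>(\<beta> in sphere_uniform. \<beta> \<bullet> a > 0 \<and> \<beta> \<bullet> c \<le> 0) = \<theta> / (2 * pi)"
  \<comment> \<open>If the sine vanishes, \<open>a\<close> and \<open>c\<close> are equal or
    opposite and span no plane; the sector is then empty or the whole half-space.\<close>
  proof (cases "sin \<theta> = 0")
    case True
    then consider "\<theta> = 0" | "\<theta> = pi" using \<theta> sin_gt_zero[of \<theta>] by fastforce
    then show ?thesis
    proof cases
      case 1
      then have "(a - c) \<bullet> (a - c) = 0"
        using cos\<theta> aa cc by (simp add: inner_simps inner_commute)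
      then have "a = c" by simp
      then have "\<P>(\<beta> in sphere_uniform. \<beta> \<bullet> a > 0 \<and> \<beta> \<bullet> c \<le> 0) = \<P>(\<beta> in sphere_uniform :: 'a measure. False)"
        by (intro arg_cong[where f="measure sphere_uniform"]) auto
      then show ?thesis using 1 by simp
    next
      case 2
      then have "(a + c) \<bullet> (a + c) = 0"
        using cos\<theta> aa cc by (simp add: inner_simps inner_commute)
      then have "c = - a" by (simp add: eq_neg_iff_add_eq_0 add.commute)
      then have "\<P>(\<beta> in sphere_uniform. \<beta> \<bullet> a > 0 \<and> \<beta> \<bullet> c \<le> 0) = \<P>(\<beta> in sphere_uniform. \<beta> \<bullet> a > 0)"
        by (intro arg_cong[where f="measure sphere_uniform"]) auto
      then show ?thesis using half 2 by simp
    qed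
  next
    case False
    \<comment> \<open>Gram-Schmidt: the part of \<open>c\<close> orthogonal to \<open>a\<close> has
      length \<open>sin \<theta>\<close>, so \<open>c\<close> is the point at angle
      \<open>\<theta>\<close> in the frame \<open>a\<close>, \<open>b\<close>.\<close>
    define b where "b = (1 / sin \<theta>) *\<^sub>R (c - cos \<theta> *\<^sub>R a)"
    have "(c - cos \<theta> *\<^sub>R a) \<bullet> (c - cos \<theta> *\<^sub>R a) = (sin \<theta>)\<^sup>2"
      unfolding sin_squared_eq
      by (simp add: inner_simps aa cc cos\<theta> inner_commute power2_eq_square)
    then have "b \<bullet> b = 1" using False by (simp add: b_def power2_eq_square)
    then have "norm b = 1" by (simp add: norm_eq_1)
    moreover have "a \<bullet> b = 0" by (simp add: b_def inner_simps aa cos\<theta>)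
    moreover have "cos \<theta> *\<^sub>R a + sin \<theta> *\<^sub>R b = c" using False by (simp add: b_def)
    ultimately show ?thesis
      using prob_sphere_uniform_sector[of a b \<theta>] a1 \<theta> by simp
  qed
  moreover have "\<P>(\<beta> in sphere_uniform. (\<beta> \<bullet> a > 0 \<and> \<beta> \<bullet> c > 0) \<or> (\<beta> \<bullet> a > 0 \<and> \<beta> \<bullet> c \<le> 0))
    = \<P>(\<beta> in sphere_uniform. \<beta> \<bullet> a > 0 \<and> \<beta> \<bullet> c > 0) + \<P>(\<beta> in sphere_uniform. \<beta> \<bullet> a > 0 \<and> \<beta> \<bullet> c \<le> 0)"
  proof (rule S.prob_disj_exclusive)
    show "\<not> ((\<beta> \<bullet> a > 0 \<and> \<beta> \<bullet> c > 0) \<and> (\<beta> \<bullet> a > 0 \<and> \<beta> \<bullet> c \<le> 0))" for \<beta>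
      by auto
  qed measurable
  moreover have "(\<beta> \<bullet> a > 0 \<and> \<beta> \<bullet> c > 0) \<or> (\<beta> \<bullet> a > 0 \<and> \<beta> \<bullet> c \<le> 0) \<longleftrightarrow> \<beta> \<bullet> a > 0" for \<beta>
    by auto
  ultimately show ?thesis
    using half unfolding pu pv \<theta>_def by simp
qed

section \<open>Fubini for probabilities and the averaged identity\<close>

lemma borel_measurable_prob:
  assumes "prob_space B"
    and [measurable]: "Measurable.pred (A \<Otimes>\<^sub>M B) (\<lambda>(x, y). Q x y)"
  shows "(\<lambda>x. \<P>(y in B. Q x y)) \<in> borel_measurable A"
proof -
  interpret B: prob_space B by fact
  show ?thesis by measurable
qed

text \<open>Both sides are the product measure of the region where \<open>Q\<close> holds, by Fubini
  applied to its indicator.\<close>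

lemma integral_prob_swap:
  assumes "prob_space A" "prob_space B"
    and [measurable]: "Measurable.pred (A \<Otimes>\<^sub>M B) (\<lambda>(x, y). Q x y)"
  shows "(\<integral>x. \<P>(y in B. Q x y) \<partial>A) = (\<integral>y. \<P>(x in A. Q x y) \<partial>B)"
proof -
  interpret A: prob_space A by fact
  interpret B: prob_space B by fact
  interpret AB: pair_prob_space A B ..
  define f :: "_ \<Rightarrow> _ \<Rightarrow> real" where "f x y = indicator {z \<in> space (A \<Otimes>\<^sub>M B). case z of (x, y) \<Rightarrow> Q x y} (x, y)" for x y
  have "integrable (A \<Otimes>\<^sub>M B) (\<lambda>z. indicator {z \<in> space (A \<Otimes>\<^sub>M B). case z of (x, y) \<Rightarrow> Q x y} z :: real)"
    by (rule AB.integrable_const_bound[where B=1]) auto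
  then have "integrable (A \<Otimes>\<^sub>M B) (case_prod f)"
    by (simp add: f_def case_prod_beta' cong: Bochner_Integration.integrable_cong)
  then have "(\<integral>y. (\<integral>x. f x y \<partial>A) \<partial>B) = (\<integral>x. (\<integral>y. f x y \<partial>B) \<partial>A)"
    by (rule AB.Fubini_integral)
  moreover have "(\<integral>x. f x y \<partial>A) = \<P>(x in A. Q x y)" if y: "y \<in> space B" for y
  proof -
    have "(\<integral>x. f x y \<partial>A) = (\<integral>x. indicator {x \<in> space A. Q x y} x \<partial>A)"
      using y by (intro Bochner_Integration.integral_cong) (auto simp: f_def space_pair_measure indicator_def)
    then show ?thesis by (auto intro!: arg_cong[where f="measure A"])
  qed
  moreover have "(\<integral>y. f x y \<partial>B) = \<P>(y in B. Q x y)" if x: "x \<in> space A" for x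
  proof -
    have "(\<integral>y. f x y \<partial>B) = (\<integral>y. indicator {y \<in> space B. Q x y} y \<partial>B)"
      using x by (intro Bochner_Integration.integral_cong) (auto simp: f_def space_pair_measure indicator_def)
    then show ?thesis by (auto intro!: arg_cong[where f="measure B"])
  qed
  ultimately show ?thesis
    by (simp cong: Bochner_Integration.integral_cong)
qed

theorem proposition7p1:
  fixes M :: "'w measure"
    and PZ :: "(real ^ 'n) measure"
    and Z1 Z2 :: "'w \<Rightarrow> real ^ 'n"
  assumes "prob_space M"
    and "prob_space PZ" and "sets PZ = sets borel"
    and "Z1 \<in> borel_measurable M" and "Z2 \<in> borel_measurable M"
    and "prob_space.indep_var M borel Z1 borel Z2"
    and "distr M borel Z1 = PZ" and "distr M borel Z2 = PZ"
    and "AE \<beta> in sphere_uniform. continuous_on UNIV (cdf (distr M borel (\<lambda>\<omega>. \<beta> \<bullet> Z1 \<omega>)))"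
  shows "(\<integral>\<beta>. (\<P>(\<omega> in M. \<beta> \<bullet> Z1 \<omega> > 0) - 1 / 2)\<^sup>2 \<partial>sphere_uniform)
       = 1 / 4 - 1 / (2 * pi) * (\<integral>\<omega>. Ang (Z1 \<omega>) (Z2 \<omega>) \<partial>M)"
proof -
  interpret prob_space M by fact
  interpret S: prob_space "sphere_uniform :: (real ^ 'n) measure" by (rule prob_space_sphere_uniform)
  note [measurable] = assms(4,5)
  \<comment> \<open>A single good direction excludes the atom: a continuous distribution function
    gives \<open>\<beta> \<bullet> Z1 \<noteq> 0\<close> almost surely, hence
    \<open>Z1 \<noteq> 0\<close>. One exists because a property that holds almost everywhere in a
    probability space holds somewhere.\<close>
  have "\<exists>\<beta>. continuous_on UNIV (cdf (distr M borel (\<lambda>\<omega>. \<beta> \<bullet> Z1 \<omega>)))"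
  proof (rule ccontr)
    assume "\<nexists>\<beta>. continuous_on UNIV (cdf (distr M borel (\<lambda>\<omega>. \<beta> \<bullet> Z1 \<omega>)))"
    with assms(9) have "AE \<beta> in (sphere_uniform :: (real ^ 'n) measure). False" by simp
    then show False by (simp add: S.AE_False)
  qed
  then obtain \<beta> where \<beta>: "continuous_on UNIV (cdf (distr M borel (\<lambda>\<omega>. \<beta> \<bullet> Z1 \<omega>)))" by blast
  interpret D: real_distribution "distr M borel (\<lambda>\<omega>. \<beta> \<bullet> Z1 \<omega>)"
    by (rule real_distribution_distr) measurable
  have "measure (distr M borel (\<lambda>\<omega>. \<beta> \<bullet> Z1 \<omega>)) {0} = 0"
    using \<beta> by (subst D.isCont_cdf[symmetric]) (auto simp: continuous_on_eq_continuous_at)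
  then have "AE x in distr M borel (\<lambda>\<omega>. \<beta> \<bullet> Z1 \<omega>). x \<notin> {0}"
    by (subst (asm) D.prob_eq_0) auto
  then have "AE \<omega> in M. \<beta> \<bullet> Z1 \<omega> \<noteq> 0"
    by (subst (asm) AE_distr_iff) auto
  then have nz1: "AE \<omega> in M. Z1 \<omega> \<noteq> 0" by eventually_elim auto
  then have "AE z in distr M borel Z1. z \<noteq> 0" by (subst AE_distr_iff) auto
  \<comment> \<open>The common law \<open>PZ\<close> carries the absence of an atom over to
    \<open>Z2\<close>.\<close>
  then have "AE z in distr M borel Z2. z \<noteq> 0" unfolding assms(7,8) .
  then have nz2: "AE \<omega> in M. Z2 \<omega> \<noteq> 0" by (subst (asm) AE_distr_iff) auto

  define G where "G \<beta> = \<P>(\<omega> in M. \<beta> \<bullet> Z1 \<omega> > 0)" for \<beta>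
  \<comment> \<open>One factor of the square is rewritten with \<open>Z2\<close> by equality of
    laws; independence then merges the two factors into a joint event.\<close>
  have G_sq: "(G \<beta>)\<^sup>2 = \<P>(\<omega> in M. \<beta> \<bullet> Z1 \<omega> > 0 \<and> \<beta> \<bullet> Z2 \<omega> > 0)" for \<beta>
  proof -
    let ?H = "{z. \<beta> \<bullet> z > 0}"
    have H: "?H \<in> sets borel" by measurable
    have Z1: "prob (Z1 -` ?H \<inter> space M) = G \<beta>"
      by (auto simp: G_def intro!: arg_cong[where f=prob])
    have "prob (Z2 -` ?H \<inter> space M) = measure (distr M borel Z2) ?H"
      using H by (simp add: measure_distr)
    also have "\<dots> = measure (distr M borel Z1) ?H" by (simp add: assms(7,8))
    also have "\<dots> = prob (Z1 -` ?H \<inter> space M)"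
      using H by (simp add: measure_distr)
    finally have Z2: "prob (Z2 -` ?H \<inter> space M) = G \<beta>" using Z1 by simp
    have "\<P>(\<omega> in M. \<beta> \<bullet> Z1 \<omega> > 0 \<and> \<beta> \<bullet> Z2 \<omega> > 0)
        = prob ((\<lambda>x. (Z1 x, Z2 x)) -` (?H \<times> ?H) \<inter> space M)"
      by (auto intro!: arg_cong[where f=prob])
    also have "\<dots> = G \<beta> * G \<beta>"
      using indep_varD[OF assms(6) H H] unfolding Z1 Z2 .
    finally show ?thesis by (simp add: power2_eq_square)
  qed
  have G_meas [measurable]: "G \<in> borel_measurable sphere_uniform"
    unfolding G_def by measurable
  have G_int: "integrable sphere_uniform G" "integrable sphere_uniform (\<lambda>\<beta>. (G \<beta>)\<^sup>2)"
    by (auto intro!: S.integrable_const_bound[where B=1] simp: G_def power_le_one)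
  have "(\<integral>\<beta>. G \<beta> \<partial>sphere_uniform) = (\<integral>\<omega>. \<P>(\<beta> in sphere_uniform. \<beta> \<bullet> Z1 \<omega> > 0) \<partial>M)"
    unfolding G_def
    by (rule integral_prob_swap[OF S.prob_space_axioms prob_space_axioms]) measurable
  also have "\<dots> = (\<integral>\<omega>. 1 / 2 \<partial>M)"
  proof (rule integral_cong_AE)
    show "(\<lambda>\<omega>. \<P>(\<beta> in sphere_uniform. \<beta> \<bullet> Z1 \<omega> > 0)) \<in> borel_measurable M"
      by (rule borel_measurable_prob[OF S.prob_space_axioms]) measurable
    show "AE \<omega> in M. \<P>(\<beta> in sphere_uniform. \<beta> \<bullet> Z1 \<omega> > 0) = 1 / 2"
      using nz1 by eventually_elim (rule prob_sphere_uniform_halfspace)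
  qed simp
  finally have int_G: "(\<integral>\<beta>. G \<beta> \<partial>sphere_uniform) = 1 / 2" by (simp add: prob_space)
  have Ang_meas [measurable]: "(\<lambda>\<omega>. Ang (Z1 \<omega>) (Z2 \<omega>)) \<in> borel_measurable M"
    by (rule borel_measurable_Ang) measurable
  have Ang_int: "integrable M (\<lambda>\<omega>. Ang (Z1 \<omega>) (Z2 \<omega>))"
    by (rule integrable_const_bound[where B=pi]) (simp_all add: Ang_nonneg Ang_le_pi)
  have "(\<integral>\<beta>. (G \<beta>)\<^sup>2 \<partial>sphere_uniform)
      = (\<integral>\<omega>. \<P>(\<beta> in sphere_uniform. \<beta> \<bullet> Z1 \<omega> > 0 \<and> \<beta> \<bullet> Z2 \<omega> > 0) \<partial>M)"
    unfolding G_sq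
    by (rule integral_prob_swap[OF S.prob_space_axioms prob_space_axioms]) measurable
  also have "\<dots> = (\<integral>\<omega>. 1 / 2 - Ang (Z1 \<omega>) (Z2 \<omega>) / (2 * pi) \<partial>M)"
  proof (rule integral_cong_AE)
    show "(\<lambda>\<omega>. \<P>(\<beta> in sphere_uniform. \<beta> \<bullet> Z1 \<omega> > 0 \<and> \<beta> \<bullet> Z2 \<omega> > 0)) \<in> borel_measurable M"
      by (rule borel_measurable_prob[OF S.prob_space_axioms]) measurable
    show "AE \<omega> in M. \<P>(\<beta> in sphere_uniform. \<beta> \<bullet> Z1 \<omega> > 0 \<and> \<beta> \<bullet> Z2 \<omega> > 0)
        = 1 / 2 - Ang (Z1 \<omega>) (Z2 \<omega>) / (2 * pi)"
      using nz1 nz2 by eventually_elim (rule prob_sphere_uniform_quadrant)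
  qed measurable
  also have "\<dots> = 1 / 2 - (\<integral>\<omega>. Ang (Z1 \<omega>) (Z2 \<omega>) \<partial>M) / (2 * pi)"
    using Ang_int by (simp add: prob_space)
  finally have int_G_sq: "(\<integral>\<beta>. (G \<beta>)\<^sup>2 \<partial>sphere_uniform) = 1 / 2 - (\<integral>\<omega>. Ang (Z1 \<omega>) (Z2 \<omega>) \<partial>M) / (2 * pi)" .
  \<comment> \<open>After expanding, the 1/2 from the quadrants cancels against the integral of
    \<open>G\<close>, leaving 1/4 and the angle term.\<close>
  have "(\<integral>\<beta>. (G \<beta> - 1 / 2)\<^sup>2 \<partial>sphere_uniform) = (\<integral>\<beta>. (G \<beta>)\<^sup>2 - G \<beta> + 1 / 4 \<partial>sphere_uniform)"
    by (simp add: power2_eq_square algebra_simps)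
  also have "\<dots> = 1 / 4 - 1 / (2 * pi) * (\<integral>\<omega>. Ang (Z1 \<omega>) (Z2 \<omega>) \<partial>M)"
    using G_int by (simp add: int_G int_G_sq S.prob_space[simplified])
  finally show ?thesis unfolding G_def .
qed

end
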